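(* Let $(T,\mu,\eta)$ be a dagger Frobenius monad on a dagger category $\mathbf{C}$. Then the Kleisli category $\mathrm{Kl}(T)$ carries a dagger that commutes with the canonical functors $\mathrm{Kl}(T)\to\mathbf{C}$ and $\mathbf{C}\to\mathrm{Kl}(T)$; that is, there is a dagger on $\mathrm{Kl}(T)$ for which both of these functors are dagger functors.
   Context: A dagger on a category $\mathbf{D}$ is a functor $\dagger\colon\mathbf{D}^{\mathrm{op}}\to\mathbf{D}$ with $A^\dagger=A$ on objects and $f^{\dagger\dagger}=f$ on morphisms; a dagger category is a category with a chosen dagger. A dagger functor is a functor $F$ between dagger categories with $F(f^\dagger)=F(f)^\dagger$. A dagger Frobenius monad on a dagger category $\mathbf{C}$ is a monad $(T,\mu,\eta)$ on $\mathbf{C}$ such that $T(f^\dagger)=T(f)^\dagger$ for all morphisms $f$ and, for every object $A$, $T(\mu_A)\circ\mu_{T(A)}^\dagger=\mu_{T(A)}\circ T(\mu_A^\dagger)$. The canonical functor $\mathbf{C}\to\mathrm{Kl}(T)$ is the identity on objects and sends $f\colon A\to B$ to the Kleisli morphism $\eta_B\circ f\colon A\to T(B)$; the canonical functor $\mathrm{Kl}(T)\to\mathbf{C}$ sends $A$ to $T(A)$ and a Kleisli morphism $f\colon A\to T(B)$ to $\mu_B\circ T(f)$. *)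

theory Defs
  imports Main
begin

text \<open>
  Hom-sets of different pairs of objects are not required to be disjoint, so that
  a Kleisli morphism from \<open>A\<close> to \<open>B\<close> can be literally a morphism from \<open>A\<close> to \<open>T B\<close>, even
  when \<open>T\<close> is not injective on objects. An operation on morphisms therefore
  takes their sources and targets as arguments: \<open>Comp C X Y Z g f\<close> is the composite of
  \<open>f : X \<rightarrow> Y\<close> and \<open>g : Y \<rightarrow> Z\<close>, and \<open>Arr F X Y f\<close> is the image of \<open>f : X \<rightarrow> Y\<close> under \<open>F\<close>.
\<close>

record ('o, 'm) cat =
  Obj :: "'o set"
  Hom :: "'o \<Rightarrow> 'o \<Rightarrow> 'm set"
  Id :: "'o \<Rightarrow> 'm"
  Comp :: "'o \<Rightarrow> 'o \<Rightarrow> 'o \<Rightarrow> 'm \<Rightarrow> 'm \<Rightarrow> 'm"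

record ('o, 'm, 'p, 'n) func =
  Ob :: "'o \<Rightarrow> 'p"
  Arr :: "'o \<Rightarrow> 'o \<Rightarrow> 'm \<Rightarrow> 'n"

locale category =
  fixes C :: "('o, 'm) cat"
  assumes Id_in_Hom: "X \<in> Obj C \<Longrightarrow> Id C X \<in> Hom C X X"
    and Comp_in_Hom:
      "\<lbrakk>X \<in> Obj C; Y \<in> Obj C; Z \<in> Obj C; f \<in> Hom C X Y; g \<in> Hom C Y Z\<rbrakk>
        \<Longrightarrow> Comp C X Y Z g f \<in> Hom C X Z"
    and Comp_Id_left:
      "\<lbrakk>X \<in> Obj C; Y \<in> Obj C; f \<in> Hom C X Y\<rbrakk> \<Longrightarrow> Comp C X Y Y (Id C Y) f = f"
    and Comp_Id_right:
      "\<lbrakk>X \<in> Obj C; Y \<in> Obj C; f \<in> Hom C X Y\<rbrakk> \<Longrightarrow> Comp C X X Y f (Id C X) = f"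
    and Comp_assoc:
      "\<lbrakk>W \<in> Obj C; X \<in> Obj C; Y \<in> Obj C; Z \<in> Obj C;
        f \<in> Hom C W X; g \<in> Hom C X Y; h \<in> Hom C Y Z\<rbrakk>
        \<Longrightarrow> Comp C W X Z (Comp C X Y Z h g) f = Comp C W Y Z h (Comp C W X Y g f)"

locale cat_functor = source: category C + target: category D
  for C :: "('o, 'm) cat" and D :: "('p, 'n) cat" +
  fixes F :: "('o, 'm, 'p, 'n) func"
  assumes Ob_in_Obj: "X \<in> Obj C \<Longrightarrow> Ob F X \<in> Obj D"
    and Arr_in_Hom:
      "\<lbrakk>X \<in> Obj C; Y \<in> Obj C; f \<in> Hom C X Y\<rbrakk> \<Longrightarrow> Arr F X Y f \<in> Hom D (Ob F X) (Ob F Y)"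
    and Arr_Id: "X \<in> Obj C \<Longrightarrow> Arr F X X (Id C X) = Id D (Ob F X)"
    and Arr_Comp:
      "\<lbrakk>X \<in> Obj C; Y \<in> Obj C; Z \<in> Obj C; f \<in> Hom C X Y; g \<in> Hom C Y Z\<rbrakk>
        \<Longrightarrow> Arr F X Z (Comp C X Y Z g f) =
              Comp D (Ob F X) (Ob F Y) (Ob F Z) (Arr F Y Z g) (Arr F X Y f)"

definition id_functor :: "('o, 'm, 'o, 'm) func" where
  "id_functor = \<lparr>Ob = (\<lambda>X. X), Arr = (\<lambda>X Y f. f)\<rparr>"

definition comp_functor ::
    "('p, 'n, 'q, 'k) func \<Rightarrow> ('o, 'm, 'p, 'n) func \<Rightarrow> ('o, 'm, 'q, 'k) func" where
  "comp_functor G F =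
    \<lparr>Ob = (\<lambda>X. Ob G (Ob F X)),
     Arr = (\<lambda>X Y f. Arr G (Ob F X) (Ob F Y) (Arr F X Y f))\<rparr>"

locale natural_transformation = F: cat_functor C D F + G: cat_functor C D G
  for C :: "('o, 'm) cat" and D :: "('p, 'n) cat"
    and F :: "('o, 'm, 'p, 'n) func" and G :: "('o, 'm, 'p, 'n) func" +
  fixes \<tau> :: "'o \<Rightarrow> 'n"
  assumes component_in_Hom: "X \<in> Obj C \<Longrightarrow> \<tau> X \<in> Hom D (Ob F X) (Ob G X)"
    and naturality:
      "\<lbrakk>X \<in> Obj C; Y \<in> Obj C; f \<in> Hom C X Y\<rbrakk>
        \<Longrightarrow> Comp D (Ob F X) (Ob F Y) (Ob G Y) (\<tau> Y) (Arr F X Y f) =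
            Comp D (Ob F X) (Ob G X) (Ob G Y) (Arr G X Y f) (\<tau> X)"

definition opposite :: "('o, 'm) cat \<Rightarrow> ('o, 'm) cat" where
  "opposite C =
    \<lparr>Obj = Obj C, Hom = (\<lambda>X Y. Hom C Y X), Id = Id C,
     Comp = (\<lambda>X Y Z g f. Comp C Z Y X f g)\<rparr>"

text \<open>
  A morphism \<open>f : X \<rightarrow> Y\<close> of \<open>D\<close> is a morphism from \<open>Y\<close> to \<open>X\<close> in the opposite category,
  hence the order of the objects below.
\<close>

definition dag :: "('o, 'm, 'o, 'm) func \<Rightarrow> 'o \<Rightarrow> 'o \<Rightarrow> 'm \<Rightarrow> 'm" where
  "dag d X Y f = Arr d Y X f"

locale dagger_category = category D + cat_functor "opposite D" D d
  for D :: "('o, 'm) cat" and d :: "('o, 'm, 'o, 'm) func" +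
  assumes dagger_Ob: "X \<in> Obj D \<Longrightarrow> Ob d X = X"
    and dagger_dagger:
      "\<lbrakk>X \<in> Obj D; Y \<in> Obj D; f \<in> Hom D X Y\<rbrakk> \<Longrightarrow> dag d Y X (dag d X Y f) = f"

locale dagger_functor =
    source: dagger_category C c + target: dagger_category D d + cat_functor C D F
  for C :: "('o, 'm) cat" and c :: "('o, 'm, 'o, 'm) func"
    and D :: "('p, 'n) cat" and d :: "('p, 'n, 'p, 'n) func"
    and F :: "('o, 'm, 'p, 'n) func" +
  assumes Arr_dagger:
    "\<lbrakk>X \<in> Obj C; Y \<in> Obj C; f \<in> Hom C X Y\<rbrakk>
      \<Longrightarrow> Arr F Y X (dag c X Y f) = dag d (Ob F X) (Ob F Y) (Arr F X Y f)"

locale monad =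
    endofunctor: cat_functor C C T +
    mult: natural_transformation C C "comp_functor T T" T \<mu> +
    unit: natural_transformation C C id_functor T \<eta>
  for C :: "('o, 'm) cat" and T :: "('o, 'm, 'o, 'm) func"
    and \<mu> :: "'o \<Rightarrow> 'm" and \<eta> :: "'o \<Rightarrow> 'm" +
  assumes mult_assoc:
      "A \<in> Obj C \<Longrightarrow>
        Comp C (Ob T (Ob T (Ob T A))) (Ob T (Ob T A)) (Ob T A)
          (\<mu> A) (Arr T (Ob T (Ob T A)) (Ob T A) (\<mu> A)) =
        Comp C (Ob T (Ob T (Ob T A))) (Ob T (Ob T A)) (Ob T A)
          (\<mu> A) (\<mu> (Ob T A))"
    and mult_unit_left:
      "A \<in> Obj C \<Longrightarrow>
        Comp C (Ob T A) (Ob T (Ob T A)) (Ob T A) (\<mu> A) (\<eta> (Ob T A)) = Id C (Ob T A)"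
    and mult_unit_right:
      "A \<in> Obj C \<Longrightarrow>
        Comp C (Ob T A) (Ob T (Ob T A)) (Ob T A) (\<mu> A) (Arr T A (Ob T A) (\<eta> A)) =
        Id C (Ob T A)"

locale dagger_frobenius_monad =
    dagger_category C d + monad C T \<mu> \<eta>
  for C :: "('o, 'm) cat" and d :: "('o, 'm, 'o, 'm) func"
    and T :: "('o, 'm, 'o, 'm) func" and \<mu> :: "'o \<Rightarrow> 'm" and \<eta> :: "'o \<Rightarrow> 'm" +
  assumes T_dagger:
      "\<lbrakk>A \<in> Obj C; B \<in> Obj C; f \<in> Hom C A B\<rbrakk>
        \<Longrightarrow> Arr T B A (dag d A B f) = dag d (Ob T A) (Ob T B) (Arr T A B f)"
    and frobenius:
      "A \<in> Obj C \<Longrightarrow>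
        Comp C (Ob T (Ob T A)) (Ob T (Ob T (Ob T A))) (Ob T (Ob T A))
          (Arr T (Ob T (Ob T A)) (Ob T A) (\<mu> A))
          (dag d (Ob T (Ob T (Ob T A))) (Ob T (Ob T A)) (\<mu> (Ob T A))) =
        Comp C (Ob T (Ob T A)) (Ob T (Ob T (Ob T A))) (Ob T (Ob T A))
          (\<mu> (Ob T A))
          (Arr T (Ob T A) (Ob T (Ob T A)) (dag d (Ob T (Ob T A)) (Ob T A) (\<mu> A)))"

definition kleisli ::
    "('o, 'm) cat \<Rightarrow> ('o, 'm, 'o, 'm) func \<Rightarrow> ('o \<Rightarrow> 'm) \<Rightarrow> ('o \<Rightarrow> 'm) \<Rightarrow> ('o, 'm) cat" where
  "kleisli C T \<mu> \<eta> =
    \<lparr>Obj = Obj C,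
     Hom = (\<lambda>A B. Hom C A (Ob T B)),
     Id = \<eta>,
     Comp = (\<lambda>X Y Z g f.
       Comp C X (Ob T (Ob T Z)) (Ob T Z) (\<mu> Z)
         (Comp C X (Ob T Y) (Ob T (Ob T Z)) (Arr T Y (Ob T Z) g) f))\<rparr>"

definition to_kleisli ::
    "('o, 'm) cat \<Rightarrow> ('o, 'm, 'o, 'm) func \<Rightarrow> ('o \<Rightarrow> 'm) \<Rightarrow> ('o, 'm, 'o, 'm) func" where
  "to_kleisli C T \<eta> =
    \<lparr>Ob = (\<lambda>A. A), Arr = (\<lambda>A B f. Comp C A B (Ob T B) (\<eta> B) f)\<rparr>"

definition from_kleisli ::
    "('o, 'm) cat \<Rightarrow> ('o, 'm, 'o, 'm) func \<Rightarrow> ('o \<Rightarrow> 'm) \<Rightarrow> ('o, 'm, 'o, 'm) func" where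
  "from_kleisli C T \<mu> =
    \<lparr>Ob = Ob T,
     Arr = (\<lambda>A B f. Comp C (Ob T A) (Ob T (Ob T B)) (Ob T B) (\<mu> B) (Arr T A (Ob T B) f))\<rparr>"

end

theory Submission
  imports Defs
begin

text \<open>
  The canonical functor \<open>E : Kl(T) \<rightarrow> C\<close>, \<open>E f = \<mu>\<^sub>B \<circ> T f\<close>, is faithful, because
  \<open>E f \<circ> \<eta>\<^sub>A = f\<close>. The dagger of \<open>f : A \<rightarrow> T B\<close> in \<open>Kl(T)\<close> is \<open>T(f\<^sup>\<dagger>) \<circ> \<mu>\<^sub>B\<^sup>\<dagger> \<circ> \<eta>\<^sub>B\<close>. The Frobenius law
  and the naturality of \<open>\<mu>\<^sup>\<dagger>\<close> show that \<open>E\<close> maps it to \<open>(E f)\<^sup>\<dagger>\<close>. By faithfulness, all the laws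
  required of the dagger on \<open>Kl(T)\<close> then reduce to laws of the dagger on \<open>C\<close>.
\<close>

lemma opposite_simps [simp]:
  "Obj (opposite C) = Obj C" "Hom (opposite C) X Y = Hom C Y X"
  "Id (opposite C) = Id C" "Comp (opposite C) X Y Z g f = Comp C Z Y X f g"
  by (simp_all add: opposite_def)

lemma kleisli_simps [simp]:
  "Obj (kleisli C T \<mu> \<eta>) = Obj C" "Hom (kleisli C T \<mu> \<eta>) A B = Hom C A (Ob T B)"
  "Id (kleisli C T \<mu> \<eta>) = \<eta>"
  by (simp_all add: kleisli_def)

lemma to_kleisli_simps [simp]:
  "Ob (to_kleisli C T \<eta>) A = A"
  "Arr (to_kleisli C T \<eta>) A B f = Comp C A B (Ob T B) (\<eta> B) f"
  by (simp_all add: to_kleisli_def)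

lemma Ob_from_kleisli [simp]: "Ob (from_kleisli C T \<mu>) = Ob T"
  by (simp add: from_kleisli_def)

section \<open>Opposite categories and the laws of a dagger\<close>

lemma (in category) category_opposite: "category (opposite C)"
  by unfold_locales
    (simp_all add: Id_in_Hom Comp_in_Hom Comp_Id_left Comp_Id_right Comp_assoc)

context dagger_category
begin

lemma dag_in_Hom:
  "\<lbrakk>X \<in> Obj D; Y \<in> Obj D; f \<in> Hom D X Y\<rbrakk> \<Longrightarrow> dag d X Y f \<in> Hom D Y X"
  using Arr_in_Hom[of Y X f] by (simp add: dag_def dagger_Ob)

lemma dag_Id: "X \<in> Obj D \<Longrightarrow> dag d X X (Id D X) = Id D X"
  using Arr_Id[of X] by (simp add: dag_def dagger_Ob)

lemma dag_Comp:
  "\<lbrakk>X \<in> Obj D; Y \<in> Obj D; Z \<in> Obj D; f \<in> Hom D X Y; g \<in> Hom D Y Z\<rbrakk>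
    \<Longrightarrow> dag d X Z (Comp D X Y Z g f) = Comp D Z Y X (dag d X Y f) (dag d Y Z g)"
  using Arr_Comp[of Z Y X g f] by (simp add: dag_def dagger_Ob)

end

text \<open>Converse to the three laws of \<open>dag\<close> just derived: a dagger can be checked
  in terms of \<open>dag\<close> alone, without passing to the opposite category.\<close>

lemma (in category) dagger_categoryI:
  assumes "\<And>X. X \<in> Obj C \<Longrightarrow> Ob d X = X"
    and "\<And>X Y f. \<lbrakk>X \<in> Obj C; Y \<in> Obj C; f \<in> Hom C X Y\<rbrakk> \<Longrightarrow> dag d X Y f \<in> Hom C Y X"
    and "\<And>X. X \<in> Obj C \<Longrightarrow> dag d X X (Id C X) = Id C X"
    and "\<And>X Y Z f g. \<lbrakk>X \<in> Obj C; Y \<in> Obj C; Z \<in> Obj C; f \<in> Hom C X Y; g \<in> Hom C Y Z\<rbrakk>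
      \<Longrightarrow> dag d X Z (Comp C X Y Z g f) = Comp C Z Y X (dag d X Y f) (dag d Y Z g)"
    and "\<And>X Y f. \<lbrakk>X \<in> Obj C; Y \<in> Obj C; f \<in> Hom C X Y\<rbrakk>
      \<Longrightarrow> dag d Y X (dag d X Y f) = f"
  shows "dagger_category C d"
  by (intro dagger_category.intro cat_functor.intro cat_functor_axioms.intro
      dagger_category_axioms.intro category_axioms category_opposite)
    (simp_all add: assms[unfolded dag_def] dag_def)

section \<open>Kleisli extension and the Kleisli category\<close>

context monad
begin

lemmas [simp] = endofunctor.source.Id_in_Hom endofunctor.source.Comp_in_Hom
  endofunctor.source.Comp_Id_left endofunctor.source.Comp_Id_right
  endofunctor.source.Comp_assoc endofunctor.Ob_in_Obj endofunctor.Arr_in_Hom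
  endofunctor.Arr_Id endofunctor.Arr_Comp

lemma mult_in_Hom [simp]: "A \<in> Obj C \<Longrightarrow> \<mu> A \<in> Hom C (Ob T (Ob T A)) (Ob T A)"
  using mult.component_in_Hom by (simp add: comp_functor_def)

lemma unit_in_Hom [simp]: "A \<in> Obj C \<Longrightarrow> \<eta> A \<in> Hom C A (Ob T A)"
  using unit.component_in_Hom by (simp add: id_functor_def)

lemma mult_naturality:
  "\<lbrakk>X \<in> Obj C; Y \<in> Obj C; f \<in> Hom C X Y\<rbrakk>
    \<Longrightarrow> Comp C (Ob T (Ob T X)) (Ob T (Ob T Y)) (Ob T Y) (\<mu> Y)
          (Arr T (Ob T X) (Ob T Y) (Arr T X Y f)) =
        Comp C (Ob T (Ob T X)) (Ob T X) (Ob T Y) (Arr T X Y f) (\<mu> X)"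
  using mult.naturality by (simp add: comp_functor_def)

lemma unit_naturality:
  "\<lbrakk>X \<in> Obj C; Y \<in> Obj C; f \<in> Hom C X Y\<rbrakk>
    \<Longrightarrow> Comp C X Y (Ob T Y) (\<eta> Y) f = Comp C X (Ob T X) (Ob T Y) (Arr T X Y f) (\<eta> X)"
  using unit.naturality by (simp add: id_functor_def)

abbreviation extend :: "'o \<Rightarrow> 'o \<Rightarrow> 'm \<Rightarrow> 'm" where
  "extend \<equiv> Arr (from_kleisli C T \<mu>)"

lemma extend_eq:
  "extend A B f = Comp C (Ob T A) (Ob T (Ob T B)) (Ob T B) (\<mu> B) (Arr T A (Ob T B) f)"
  by (simp add: from_kleisli_def)

lemma extend_in_Hom [simp]:
  "\<lbrakk>A \<in> Obj C; B \<in> Obj C; f \<in> Hom C A (Ob T B)\<rbrakk>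
    \<Longrightarrow> extend A B f \<in> Hom C (Ob T A) (Ob T B)"
  by (simp add: extend_eq)

text \<open>Naturality of \<open>\<eta>\<close> at \<open>f\<close> moves the unit to the left of
  \<open>f\<close>, where the left unit law cancels it against \<open>\<mu> B\<close>.\<close>

lemma extend_unit:
  assumes [simp]: "A \<in> Obj C" "B \<in> Obj C" "f \<in> Hom C A (Ob T B)"
  shows "Comp C A (Ob T A) (Ob T B) (extend A B f) (\<eta> A) = f"
proof -
  let ?TA = "Ob T A" and ?TB = "Ob T B" and ?TTB = "Ob T (Ob T B)"
  have "Comp C A ?TA ?TB (extend A B f) (\<eta> A) =
      Comp C A ?TTB ?TB (\<mu> B) (Comp C A ?TB ?TTB (\<eta> ?TB) f)"
    by (simp add: extend_eq unit_naturality)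
  also have "\<dots> = Comp C A ?TB ?TB (Comp C ?TB ?TTB ?TB (\<mu> B) (\<eta> ?TB)) f"
    by simp
  finally show ?thesis by (simp add: mult_unit_left)
qed

lemma extend_inject:
  assumes "A \<in> Obj C" "B \<in> Obj C" "f \<in> Hom C A (Ob T B)" "g \<in> Hom C A (Ob T B)"
    and "extend A B f = extend A B g"
  shows "f = g"
  using assms extend_unit by metis

lemma extend_Id: "A \<in> Obj C \<Longrightarrow> extend A A (\<eta> A) = Id C (Ob T A)"
  by (simp add: extend_eq mult_unit_right)

text \<open>The right unit law gives this. It identifies the composite of the two canonical functors
  with \<open>T\<close>, so that facts about \<open>T\<close> transfer to
  \<open>to_kleisli\<close>.\<close>

lemma extend_to_kleisli:
  assumes [simp]: "A \<in> Obj C" "B \<in> Obj C" "f \<in> Hom C A B"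
  shows "extend A B (Comp C A B (Ob T B) (\<eta> B) f) = Arr T A B f"
proof -
  let ?TA = "Ob T A" and ?TB = "Ob T B" and ?TTB = "Ob T (Ob T B)"
  have "extend A B (Comp C A B ?TB (\<eta> B) f) =
      Comp C ?TA ?TB ?TB (Comp C ?TB ?TTB ?TB (\<mu> B) (Arr T B ?TB (\<eta> B))) (Arr T A B f)"
    by (simp add: extend_eq)
  then show ?thesis by (simp add: mult_unit_right del: endofunctor.source.Comp_assoc)
qed

text \<open>Rebracketing expresses Kleisli composition through \<open>extend\<close>, so that the
  laws of \<open>extend\<close> suffice from here on.\<close>

lemma Comp_kleisli:
  assumes "X \<in> Obj C" "Y \<in> Obj C" "Z \<in> Obj C" "f \<in> Hom C X (Ob T Y)" "g \<in> Hom C Y (Ob T Z)"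
  shows "Comp (kleisli C T \<mu> \<eta>) X Y Z g f = Comp C X (Ob T Y) (Ob T Z) (extend Y Z g) f"
  using assms by (simp add: kleisli_def extend_eq)

lemma extend_Comp:
  assumes [simp]: "X \<in> Obj C" "Y \<in> Obj C" "Z \<in> Obj C"
    "f \<in> Hom C X (Ob T Y)" "g \<in> Hom C Y (Ob T Z)"
  shows "extend X Z (Comp (kleisli C T \<mu> \<eta>) X Y Z g f) =
    Comp C (Ob T X) (Ob T Y) (Ob T Z) (extend Y Z g) (extend X Y f)"
proof -
  let ?T = "Ob T"
  let ?Tf = "Arr T X (?T Y) f" and ?Tg = "Arr T Y (?T Z) g"
  let ?TTg = "Arr T (?T Y) (?T (?T Z)) ?Tg"
  have "extend X Z (Comp (kleisli C T \<mu> \<eta>) X Y Z g f) =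
    Comp C (?T X) (?T (?T (?T Z))) (?T Z)
      (Comp C (?T (?T (?T Z))) (?T (?T Z)) (?T Z) (\<mu> Z) (Arr T (?T (?T Z)) (?T Z) (\<mu> Z)))
      (Comp C (?T X) (?T (?T Y)) (?T (?T (?T Z))) ?TTg ?Tf)"
    by (simp add: Comp_kleisli extend_eq)
  also have "\<dots> = Comp C (?T X) (?T (?T Z)) (?T Z) (\<mu> Z)
      (Comp C (?T X) (?T (?T Y)) (?T (?T Z))
        (Comp C (?T (?T Y)) (?T (?T (?T Z))) (?T (?T Z)) (\<mu> (?T Z)) ?TTg) ?Tf)"
    \<comment> \<open>Associativity trades \<open>T \<mu>\<close> at \<open>Z\<close> for
      \<open>\<mu>\<close> at \<open>T Z\<close>, which now stands next to \<open>?TTg\<close> and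
      can pass it by naturality at \<open>g\<close>.\<close>
    unfolding mult_assoc[OF assms(3)] by simp
  also have "\<dots> = Comp C (?T X) (?T Y) (?T Z) (extend Y Z g) (extend X Y f)"
    unfolding mult_naturality[OF assms(2) endofunctor.Ob_in_Obj[OF assms(3)] assms(5)]
    by (simp add: extend_eq)
  finally show ?thesis .
qed

lemma category_kleisli: "category (kleisli C T \<mu> \<eta>)"
proof
  fix W X Y Z f g h
  assume [simplified, simp]: "W \<in> Obj (kleisli C T \<mu> \<eta>)" "X \<in> Obj (kleisli C T \<mu> \<eta>)"
    "Y \<in> Obj (kleisli C T \<mu> \<eta>)" "Z \<in> Obj (kleisli C T \<mu> \<eta>)"
    "f \<in> Hom (kleisli C T \<mu> \<eta>) W X" "g \<in> Hom (kleisli C T \<mu> \<eta>) X Y"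
    "h \<in> Hom (kleisli C T \<mu> \<eta>) Y Z"
  have "Comp (kleisli C T \<mu> \<eta>) X Y Z h g \<in> Hom C X (Ob T Z)"
    "Comp (kleisli C T \<mu> \<eta>) W X Y g f \<in> Hom C W (Ob T Y)"
    by (simp_all add: Comp_kleisli)
  then show "Comp (kleisli C T \<mu> \<eta>) W X Z (Comp (kleisli C T \<mu> \<eta>) X Y Z h g) f =
      Comp (kleisli C T \<mu> \<eta>) W Y Z h (Comp (kleisli C T \<mu> \<eta>) W X Y g f)"
    \<comment> \<open>The composite of \<open>g\<close> and \<open>h\<close> stays folded so that
      \<open>extend_Comp\<close> applies to it; what remains is associativity in
      \<open>C\<close>.\<close>
    using extend_Comp[of X Y Z g h]
    by (simp add: Comp_kleisli[of W X Z] Comp_kleisli[of W Y Z] Comp_kleisli[of W X Y])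
qed (simp_all add: Comp_kleisli extend_Id extend_unit)

lemma cat_functor_from_kleisli: "cat_functor (kleisli C T \<mu> \<eta>) C (from_kleisli C T \<mu>)"
proof -
  interpret K: category "kleisli C T \<mu> \<eta>" by (rule category_kleisli)
  show ?thesis
    by unfold_locales (simp_all add: extend_Id extend_Comp)
qed

lemma cat_functor_to_kleisli: "cat_functor C (kleisli C T \<mu> \<eta>) (to_kleisli C T \<eta>)"
proof -
  interpret K: category "kleisli C T \<mu> \<eta>" by (rule category_kleisli)
  show ?thesis
  proof
    fix X Y Z f g
    assume [simp]: "X \<in> Obj C" "Y \<in> Obj C" "Z \<in> Obj C" "f \<in> Hom C X Y" "g \<in> Hom C Y Z"
    show "Arr (to_kleisli C T \<eta>) X Z (Comp C X Y Z g f) =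
      Comp (kleisli C T \<mu> \<eta>) (Ob (to_kleisli C T \<eta>) X) (Ob (to_kleisli C T \<eta>) Y)
        (Ob (to_kleisli C T \<eta>) Z) (Arr (to_kleisli C T \<eta>) Y Z g)
        (Arr (to_kleisli C T \<eta>) X Y f)"
      \<comment> \<open>By \<open>extend_to_kleisli\<close> the Kleisli composite is
        \<open>T g \<circ> \<eta> Y \<circ> f\<close>, so naturality of \<open>\<eta>\<close> at
        \<open>g\<close>, precomposed with \<open>f\<close>, is what is needed.\<close>
      using arg_cong[OF unit_naturality[of Y Z g], of "\<lambda>h. Comp C X Y (Ob T Z) h f"]
      by (simp add: Comp_kleisli extend_to_kleisli)
  qed simp_all
qed

end

section \<open>The dagger on the Kleisli category\<close>

text \<open>The map \<open>\<mu>\<^sup>\<dagger> \<circ> \<eta>\<close> from \<open>B\<close> to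
  \<open>T (T B)\<close> is the unit of a self-adjunction of \<open>T\<close>, and the formula is
  the transpose of \<open>f\<^sup>\<dagger>\<close> from \<open>T B\<close> to \<open>A\<close>. The
  objects are bound as \<open>B A\<close> because the functor starts from the opposite
  category.\<close>

definition kleisli_dagger ::
    "('o, 'm) cat \<Rightarrow> ('o, 'm, 'o, 'm) func \<Rightarrow> ('o, 'm, 'o, 'm) func \<Rightarrow> ('o \<Rightarrow> 'm) \<Rightarrow> ('o \<Rightarrow> 'm)
      \<Rightarrow> ('o, 'm, 'o, 'm) func" where
  "kleisli_dagger C d T \<mu> \<eta> =
    \<lparr>Ob = (\<lambda>A. A),
     Arr = (\<lambda>B A f.
       Comp C B (Ob T (Ob T B)) (Ob T A) (Arr T (Ob T B) A (dag d A (Ob T B) f))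
         (Comp C B (Ob T B) (Ob T (Ob T B)) (dag d (Ob T (Ob T B)) (Ob T B) (\<mu> B)) (\<eta> B)))\<rparr>"

context dagger_frobenius_monad
begin

lemmas [simp] = dag_in_Hom dag_Id dag_Comp dagger_dagger

abbreviation comult :: "'o \<Rightarrow> 'm" where
  "comult A \<equiv> dag d (Ob T (Ob T A)) (Ob T A) (\<mu> A)"

abbreviation kdag :: "'o \<Rightarrow> 'o \<Rightarrow> 'm \<Rightarrow> 'm" where
  "kdag \<equiv> dag (kleisli_dagger C d T \<mu> \<eta>)"

text \<open>This is the dagger of the naturality of \<open>\<mu>\<close> at
  \<open>f\<^sup>\<dagger>\<close>; since \<open>T\<close> preserves daggers, both daggers on
  \<open>f\<close> cancel.\<close>

lemma comult_naturality:
  assumes [simp]: "X \<in> Obj C" "Y \<in> Obj C" "f \<in> Hom C X Y"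
  shows "Comp C (Ob T X) (Ob T Y) (Ob T (Ob T Y)) (comult Y) (Arr T X Y f) =
    Comp C (Ob T X) (Ob T (Ob T X)) (Ob T (Ob T Y)) (Arr T (Ob T X) (Ob T Y) (Arr T X Y f))
      (comult X)"
  using arg_cong[OF mult_naturality[of Y X "dag d X Y f"],
      of "dag d (Ob T (Ob T Y)) (Ob T X)"]
  by (simp add: T_dagger)

lemma kdag_eq:
  "kdag A B f = Comp C B (Ob T (Ob T B)) (Ob T A) (Arr T (Ob T B) A (dag d A (Ob T B) f))
     (Comp C B (Ob T B) (Ob T (Ob T B)) (comult B) (\<eta> B))"
  by (simp add: kleisli_dagger_def dag_def)

lemma kdag_in_Hom [simp]:
  "\<lbrakk>A \<in> Obj C; B \<in> Obj C; f \<in> Hom C A (Ob T B)\<rbrakk> \<Longrightarrow> kdag A B f \<in> Hom C B (Ob T A)"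
  by (simp add: kdag_eq)

text \<open>The heart of the proof and the only place where the Frobenius law enters. It is the case
  of \<open>extend_kdag\<close> in which \<open>f\<close> is the identity of
  \<open>T B\<close>.\<close>

lemma extend_comult_unit:
  assumes [simp]: "B \<in> Obj C"
  shows "extend B (Ob T B) (Comp C B (Ob T B) (Ob T (Ob T B)) (comult B) (\<eta> B)) = comult B"
proof -
  let ?T = "Ob T"
  let ?Teta = "Arr T B (?T B) (\<eta> B)" and ?Tmult = "Arr T (?T (?T B)) (?T B) (\<mu> B)"
  have "extend B (?T B) (Comp C B (?T B) (?T (?T B)) (comult B) (\<eta> B)) =
      Comp C (?T B) (?T (?T B)) (?T (?T B))
        (Comp C (?T (?T B)) (?T (?T (?T B))) (?T (?T B)) (\<mu> (?T B))
          (Arr T (?T B) (?T (?T B)) (comult B))) ?Teta"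
    by (simp add: extend_eq)
  also have "\<dots> = Comp C (?T B) (?T (?T (?T B))) (?T (?T B)) ?Tmult
      (Comp C (?T B) (?T (?T B)) (?T (?T (?T B))) (comult (?T B)) ?Teta)"
    \<comment> \<open>The Frobenius law moves the comultiplication to the right, next to
      \<open>?Teta\<close>. Its naturality at \<open>\<eta> B\<close> then brings
      \<open>\<mu> B\<close> and \<open>?Teta\<close> together under \<open>T\<close>, where the
      right unit law cancels them.\<close>
    unfolding frobenius[OF assms, symmetric] by simp
  also have "\<dots> = Comp C (?T B) (?T (?T B)) (?T (?T B))
      (Arr T (?T B) (?T B) (Comp C (?T B) (?T (?T B)) (?T B) (\<mu> B) ?Teta)) (comult B)"
    by (simp add: comult_naturality)
  finally show ?thesis
    unfolding mult_unit_right[OF assms] by simp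
qed

text \<open>Naturality of \<open>\<mu>\<close> at \<open>f\<^sup>\<dagger>\<close> pulls
  \<open>T (f\<^sup>\<dagger>)\<close> out of the extension. The rest is the extension of
  \<open>?u\<close>, namely \<open>\<mu>\<^sup>\<dagger>\<close>, and
  \<open>T (f\<^sup>\<dagger>) \<circ> \<mu>\<^sup>\<dagger>\<close> is the dagger of
  \<open>\<mu> \<circ> T f\<close>.\<close>

lemma extend_kdag:
  assumes [simp]: "A \<in> Obj C" "B \<in> Obj C" "f \<in> Hom C A (Ob T B)"
  shows "extend B A (kdag A B f) = dag d (Ob T A) (Ob T B) (extend A B f)"
proof -
  let ?T = "Ob T" and ?f = "dag d A (Ob T B) f"
  let ?u = "Comp C B (?T B) (?T (?T B)) (comult B) (\<eta> B)"
  have "extend B A (kdag A B f) = Comp C (?T B) (?T (?T (?T B))) (?T A)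
      (Comp C (?T (?T (?T B))) (?T (?T A)) (?T A) (\<mu> A)
        (Arr T (?T (?T B)) (?T A) (Arr T (?T B) A ?f))) (Arr T B (?T (?T B)) ?u)"
    by (simp add: extend_eq kdag_eq)
  also have "\<dots> = Comp C (?T B) (?T (?T B)) (?T A) (Arr T (?T B) A ?f) (extend B (?T B) ?u)"
    unfolding mult_naturality[OF endofunctor.Ob_in_Obj[OF assms(2)] assms(1)
        dag_in_Hom[OF assms(1) endofunctor.Ob_in_Obj[OF assms(2)] assms(3)]]
    by (simp add: extend_eq)
  also have "\<dots> = dag d (?T A) (?T B) (extend A B f)"
    unfolding extend_comult_unit[OF assms(2)] by (simp add: extend_eq T_dagger)
  finally show ?thesis .
qed

lemma dagger_category_kleisli:
  "dagger_category (kleisli C T \<mu> \<eta>) (kleisli_dagger C d T \<mu> \<eta>)"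
proof (rule category.dagger_categoryI[OF category_kleisli], unfold kleisli_simps)
  show "Ob (kleisli_dagger C d T \<mu> \<eta>) X = X" for X
    by (simp add: kleisli_dagger_def)
  show "kdag X X (\<eta> X) = \<eta> X" if "X \<in> Obj C" for X
    by (rule extend_inject[of X X]) (use that in \<open>simp_all add: extend_kdag extend_Id\<close>)
  show "kdag X Z (Comp (kleisli C T \<mu> \<eta>) X Y Z g f) =
      Comp (kleisli C T \<mu> \<eta>) Z Y X (kdag X Y f) (kdag Y Z g)"
    if [simp]: "X \<in> Obj C" "Y \<in> Obj C" "Z \<in> Obj C"
      "f \<in> Hom C X (Ob T Y)" "g \<in> Hom C Y (Ob T Z)" for X Y Z f g
  proof (rule extend_inject[of Z X])
    have [simp]: "Comp (kleisli C T \<mu> \<eta>) X Y Z g f \<in> Hom C X (Ob T Z)"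
      by (simp add: Comp_kleisli)
    show "kdag X Z (Comp (kleisli C T \<mu> \<eta>) X Y Z g f) \<in> Hom C Z (Ob T X)"
      by simp
    \<comment> \<open>Both sides become the composite of the daggers of the two extensions, by
      contravariance of the dagger on \<open>C\<close>.\<close>
    show "extend Z X (kdag X Z (Comp (kleisli C T \<mu> \<eta>) X Y Z g f)) =
        extend Z X (Comp (kleisli C T \<mu> \<eta>) Z Y X (kdag X Y f) (kdag Y Z g))"
      by (simp add: extend_kdag extend_Comp)
  qed (simp_all add: Comp_kleisli)
  show "kdag Y X (kdag X Y f) = f"
    if "X \<in> Obj C" "Y \<in> Obj C" "f \<in> Hom C X (Ob T Y)" for X Y f
    by (rule extend_inject[of X Y]) (use that in \<open>simp_all add: extend_kdag\<close>)
qed simp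

lemma dagger_functor_from_kleisli:
  "dagger_functor (kleisli C T \<mu> \<eta>) (kleisli_dagger C d T \<mu> \<eta>) C d (from_kleisli C T \<mu>)"
  by (intro dagger_functor.intro dagger_functor_axioms.intro dagger_category_kleisli
      cat_functor_from_kleisli dagger_category_axioms) (simp add: extend_kdag)

lemma dagger_functor_to_kleisli:
  "dagger_functor C d (kleisli C T \<mu> \<eta>) (kleisli_dagger C d T \<mu> \<eta>) (to_kleisli C T \<eta>)"
proof (intro dagger_functor.intro dagger_functor_axioms.intro dagger_category_kleisli
    cat_functor_to_kleisli dagger_category_axioms)
  fix X Y f
  assume [simp]: "X \<in> Obj C" "Y \<in> Obj C" "f \<in> Hom C X Y"
  show "Arr (to_kleisli C T \<eta>) Y X (dag d X Y f) =
      kdag (Ob (to_kleisli C T \<eta>) X) (Ob (to_kleisli C T \<eta>) Y) (Arr (to_kleisli C T \<eta>) X Y f)"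
    \<comment> \<open>Both sides extend to \<open>(T f)\<^sup>\<dagger>\<close>: the left one
      because \<open>T\<close> preserves daggers, the right one by
      \<open>extend_kdag\<close>.\<close>
    by (rule extend_inject[of Y X])
      (simp_all add: extend_kdag extend_to_kleisli T_dagger del: dag_Comp)
qed

end

theorem lemma6p1:
  fixes C :: "('o, 'm) cat" and d :: "('o, 'm, 'o, 'm) func"
    and T :: "('o, 'm, 'o, 'm) func" and \<mu> :: "'o \<Rightarrow> 'm" and \<eta> :: "'o \<Rightarrow> 'm"
  assumes "dagger_frobenius_monad C d T \<mu> \<eta>"
  shows "\<exists>k. dagger_category (kleisli C T \<mu> \<eta>) k \<and>
             dagger_functor (kleisli C T \<mu> \<eta>) k C d (from_kleisli C T \<mu>) \<and>
             dagger_functor C d (kleisli C T \<mu> \<eta>) k (to_kleisli C T \<eta>)"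
proof -
  interpret dagger_frobenius_monad C d T \<mu> \<eta> by (rule assms)
  show ?thesis
    using dagger_category_kleisli dagger_functor_from_kleisli dagger_functor_to_kleisli by blast
qed

end
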